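(* Let $a=48329$, $b=156$, $u=2047435741791027199$, $v=745665546122880$. Define integer sequences $(z_n)_{n\ge 0}$ and $(m_n)_{n\ge 0}$ by $z_0=5$, $m_0=88$ and, for $n\ge 0$, $$z_{n+1}=u z_n+bv\,m_n,\qquad m_{n+1}=av\,z_n+u m_n.$$ For every $n\ge0$ define $$A_n=\frac{317z_n-2m_n+1}{2},\qquad B_n=200z_n-m_n+1.$$ Then for every $n\ge 0$, $m_n,A_n,B_n$ are positive integers, $$B_n>A_n+2m_n-1,$$ and $$\sum_{j=0}^{2m_n-1}(A_n+j)^3=\sum_{j=0}^{m_n-1}(B_n+2j)^3.$$ Consequently there are infinitely many ordered cubic runs, i.e. infinitely many triples $(m,A,B)$ of positive integers with $B>A+2m-1$ and $$\sum_{j=0}^{2m-1}(A+j)^3=\sum_{j=0}^{m-1}(B+2j)^3.$$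
   Context: An ordered cubic run (of the form considered here) is an identity $\sum_{j=0}^{2m-1}(A+j)^3=\sum_{j=0}^{m-1}(B+2j)^3$ with positive integers $m,A,B$ satisfying the ordering condition $B>A+2m-1$. The pair $(u,v)$ is the least positive integer solution of the Pell equation $u^2-Dv^2=1$ with $D=ab=7539324$. *)

theory Defs
  imports Complex_Main
begin

definition coeff_a :: int where "coeff_a = 48329"
definition coeff_b :: int where "coeff_b = 156"

(* (pell_u, pell_v) solves u^2 - D v^2 = 1 for D = coeff_a * coeff_b = 7539324. *)
definition pell_u :: int where "pell_u = 2047435741791027199"
definition pell_v :: int where "pell_v = 745665546122880"

fun z_seq :: "nat \<Rightarrow> int" and m_seq :: "nat \<Rightarrow> int" where
  "z_seq 0 = 5"
| "m_seq 0 = 88"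
| "z_seq (Suc n) = pell_u * z_seq n + coeff_b * pell_v * m_seq n"
| "m_seq (Suc n) = coeff_a * pell_v * z_seq n + pell_u * m_seq n"

(* Rational-valued, so that the quotient by 2 is exact; integrality is something to be proved. *)
definition A_seq :: "nat \<Rightarrow> rat" where
  "A_seq n = (317 * of_int (z_seq n) - 2 * of_int (m_seq n) + 1) / 2"

definition B_seq :: "nat \<Rightarrow> int" where
  "B_seq n = 200 * z_seq n - m_seq n + 1"

definition ordered_cubic_run :: "int \<Rightarrow> int \<Rightarrow> int \<Rightarrow> bool" where
  "ordered_cubic_run m A B \<longleftrightarrow>
     m > 0 \<and> A > 0 \<and> B > 0 \<and> B > A + 2 * m - 1 \<and>
     (\<Sum>j = 0..2 * m - 1. (A + j) ^ 3) = (\<Sum>j = 0..m - 1. (B + 2 * j) ^ 3)"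

end

theory Submission
  imports Defs
begin

text \<open>
  A progression of cubes is governed by its length \<open>n\<close>, its step \<open>d\<close> and twice its mean
  \<open>c\<close>: its sum is one eighth of \<open>n * c * (c\<^sup>2 + d\<^sup>2 * (n\<^sup>2 - 1))\<close>
  (lemma \<open>sum_cubes_progression\<close>).  The formulas for \<open>A\<close> and \<open>B\<close> are
  chosen so that the two doubled means are \<open>317 * z\<close> and \<open>400 * z\<close>.  Both are
  multiples of \<open>z\<close>, so after cancelling \<open>m * z\<close> the equality of the two sums is
  quadratic in \<open>z\<close> and \<open>m\<close>; it is the generalized Pell equation
  \<open>a * z\<^sup>2 - b * m\<^sup>2 = 161\<close> with \<open>a = 48329\<close> and \<open>b = 156\<close>.
  The same equation bounds \<open>m / z\<close> by \<open>sqrt (a / b)\<close>, which is less than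
  \<open>18\<close>; that is more than enough for the positivity and ordering conditions.  Hence every
  positive solution with \<open>z\<close> odd gives an ordered cubic run (lemma
  \<open>run_of_pell_solution\<close>).

  The recurrence multiplies \<open>z * sqrt a + m * sqrt b\<close> by the unit
  \<open>u + v * sqrt (a * b)\<close> of norm \<open>1\<close>, so it preserves the Pell equation; it
  preserves the parity of \<open>z\<close> because \<open>u\<close> is odd and \<open>v\<close> is even; and it
  makes \<open>m\<close> grow strictly, so the runs obtained are pairwise distinct.
\<close>

text \<open>
  Expanding about the mean \<open>c / 2\<close> kills the odd powers of the deviation, leaving
  \<open>n * (c / 2)^3\<close> plus \<open>3 * c / 2\<close> times the sum of the squared deviations, which
  is \<open>d\<^sup>2 * n * (n\<^sup>2 - 1) / 12\<close>.  The factor \<open>8\<close> clears the denominators.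
\<close>

lemma sum_cubes_progression:
  fixes x d n :: int
  assumes "n \<ge> 0"
  defines "c \<equiv> 2 * x + d * (n - 1)"
  shows "8 * (\<Sum>j = 0..n - 1. (x + d * j) ^ 3) = n * c * (c\<^sup>2 + d\<^sup>2 * (n\<^sup>2 - 1))"
  unfolding c_def using assms(1)
proof (induction n rule: int_ge_induct)
  case base
  show ?case by simp
next
  case (step n)
  have "{0..n + 1 - 1} = insert n {0..n - 1}"
    using step.hyps by auto
  then have "8 * (\<Sum>j = 0..n + 1 - 1. (x + d * j) ^ 3)
      = 8 * (x + d * n) ^ 3 + 8 * (\<Sum>j = 0..n - 1. (x + d * j) ^ 3)"
    by simp
  then show ?case
    unfolding step.IH by (simp add: power2_eq_square power3_eq_cube algebra_simps)
qed

lemma pell_solution_bound: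
  fixes z m :: int
  assumes "z > 0" and "48329 * z\<^sup>2 - 156 * m\<^sup>2 = 161"
  shows "m < 18 * z"
proof -
  have "z\<^sup>2 > 0"
    using assms(1) by simp
  then have "m\<^sup>2 < 324 * z\<^sup>2"
    using assms(2) by linarith
  also have "\<dots> = (18 * z)\<^sup>2"
    by (simp add: power_mult_distrib)
  finally show ?thesis
    by (rule power2_less_imp_less) (use assms(1) in simp)
qed

text \<open>
  Here \<open>A\<close> is given by its double, since \<open>A\<close> is an integer exactly when \<open>z\<close>
  is odd.
\<close>

lemma run_of_pell_solution:
  fixes z m A :: int
  assumes "z > 0" and "m > 0" and pell: "48329 * z\<^sup>2 - 156 * m\<^sup>2 = 161"
    and A: "2 * A = 317 * z - 2 * m + 1"
  shows "ordered_cubic_run m A (200 * z - m + 1)"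
proof -
  define B where "B = 200 * z - m + 1"
  have bound: "m < 18 * z"
    using assms(1) pell by (rule pell_solution_bound)
  have meanA: "2 * A + 1 * (2 * m - 1) = 317 * z"
    using A by simp
  have meanB: "2 * B + 2 * (m - 1) = 400 * z"
    by (simp add: B_def)
  have sumA: "8 * (\<Sum>j = 0..2 * m - 1. (A + j) ^ 3)
      = 2 * m * (317 * z) * ((317 * z)\<^sup>2 + ((2 * m)\<^sup>2 - 1))"
    using sum_cubes_progression[of "2 * m" A 1] \<open>m > 0\<close> unfolding meanA by simp
  have sumB: "8 * (\<Sum>j = 0..m - 1. (B + 2 * j) ^ 3)
      = m * (400 * z) * ((400 * z)\<^sup>2 + 2\<^sup>2 * (m\<^sup>2 - 1))"
    using sum_cubes_progression[of m B 2] \<open>m > 0\<close> unfolding meanB by simp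
  \<comment> \<open>Without the common factor \<open>2 * m * z\<close>, the difference of the two right-hand sides
      is \<open>-3\<close> times the defect in the Pell equation.\<close>
  have "317 * ((317 * z)\<^sup>2 + ((2 * m)\<^sup>2 - 1))
      = 200 * ((400 * z)\<^sup>2 + 2\<^sup>2 * (m\<^sup>2 - 1))"
    using pell by (simp add: power_mult_distrib)
  then have "(2 * m * z) * (317 * ((317 * z)\<^sup>2 + ((2 * m)\<^sup>2 - 1)))
      = (2 * m * z) * (200 * ((400 * z)\<^sup>2 + 2\<^sup>2 * (m\<^sup>2 - 1)))"
    by (rule arg_cong)
  then have "8 * (\<Sum>j = 0..2 * m - 1. (A + j) ^ 3) = 8 * (\<Sum>j = 0..m - 1. (B + 2 * j) ^ 3)"
    unfolding sumA sumB by (simp add: ac_simps)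
  moreover have "A > 0" "B > 0" "B > A + 2 * m - 1"
    using A bound \<open>z > 0\<close> by (simp_all add: B_def)
  ultimately show ?thesis
    using \<open>m > 0\<close> by (simp add: ordered_cubic_run_def B_def)
qed

lemma pell_unit_norm: "pell_u\<^sup>2 - coeff_a * coeff_b * pell_v\<^sup>2 = 1"
  by (simp add: pell_u_def pell_v_def coeff_a_def coeff_b_def)

text \<open>
  Multiplicativity of the norm of \<open>z * sqrt a + m * sqrt b\<close> under multiplication by
  \<open>u + v * sqrt (a * b)\<close>.
\<close>

lemma pell_norm_mult:
  fixes a b u v z m :: "'a :: comm_ring_1"
  shows "a * (u * z + b * v * m)\<^sup>2 - b * (a * v * z + u * m)\<^sup>2
    = (u\<^sup>2 - a * b * v\<^sup>2) * (a * z\<^sup>2 - b * m\<^sup>2)"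
  by (simp add: power2_eq_square algebra_simps)

lemma pell_seq: "48329 * (z_seq n)\<^sup>2 - 156 * (m_seq n)\<^sup>2 = 161"
proof -
  have "coeff_a * (z_seq n)\<^sup>2 - coeff_b * (m_seq n)\<^sup>2 = 161"
  proof (induction n)
    case 0
    show ?case by (simp add: coeff_a_def coeff_b_def)
  next
    case (Suc n)
    then show ?case by (simp add: pell_norm_mult pell_unit_norm)
  qed
  then show ?thesis by (simp add: coeff_a_def coeff_b_def)
qed

lemma seq_pos: "z_seq n > 0 \<and> m_seq n > 0"
  by (induction n) (auto simp: pell_u_def pell_v_def coeff_a_def coeff_b_def)

lemma odd_z_seq: "odd (z_seq n)"
  by (induction n) (auto simp: pell_u_def pell_v_def)

lemma strict_mono_m_seq: "strict_mono m_seq"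
proof (rule strict_mono_Suc_iff[THEN iffD2, rule_format])
  fix n
  show "m_seq n < m_seq (Suc n)"
    using seq_pos[of n] by (simp add: pell_u_def pell_v_def coeff_a_def)
qed

definition A_int :: "nat \<Rightarrow> int" where
  "A_int n = (317 * z_seq n - 2 * m_seq n + 1) div 2"

lemma double_A_int: "2 * A_int n = 317 * z_seq n - 2 * m_seq n + 1"
proof -
  have "even (317 * z_seq n - 2 * m_seq n + 1)"
    using odd_z_seq[of n] by simp
  then show ?thesis
    unfolding A_int_def by (rule dvd_mult_div_cancel)
qed

lemma A_seq_eq: "A_seq n = of_int (A_int n)"
proof -
  have "2 * (of_int (A_int n) :: rat) = of_int (2 * A_int n)"
    by simp
  also have "\<dots> = 2 * A_seq n"
    unfolding double_A_int by (simp add: A_seq_def)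
  finally show ?thesis by simp
qed

lemma run_seq: "ordered_cubic_run (m_seq n) (A_int n) (B_seq n)"
  unfolding B_seq_def
  using seq_pos[of n] pell_seq double_A_int by (intro run_of_pell_solution) auto

theorem theorem1:
  shows "(\<forall>n. m_seq n > 0 \<and> A_seq n \<in> \<int> \<and> A_seq n > 0 \<and> B_seq n > 0 \<and>
              of_int (B_seq n) > A_seq n + 2 * of_int (m_seq n) - 1 \<and>
              (\<Sum>j = 0..2 * m_seq n - 1. (A_seq n + of_int j) ^ 3) =
                of_int (\<Sum>j = 0..m_seq n - 1. (B_seq n + 2 * j) ^ 3)) \<and>
         infinite {(m, A, B). ordered_cubic_run m A B}"
proof (intro conjI allI)
  fix n
  have run: "m_seq n > 0" "A_int n > 0" "B_seq n > 0" "B_seq n > A_int n + 2 * m_seq n - 1"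
    "(\<Sum>j = 0..2 * m_seq n - 1. (A_int n + j) ^ 3)
      = (\<Sum>j = 0..m_seq n - 1. (B_seq n + 2 * j) ^ 3)"
    using run_seq[of n] by (simp_all add: ordered_cubic_run_def)
  show "m_seq n > 0" and "B_seq n > 0"
    using run by simp_all
  show "A_seq n \<in> \<int>" and "A_seq n > 0"
    using run by (simp_all add: A_seq_eq)
  have "(of_int (A_int n + 2 * m_seq n - 1) :: rat) < of_int (B_seq n)"
    using run(4) by (simp only: of_int_less_iff)
  then show "of_int (B_seq n) > A_seq n + 2 * of_int (m_seq n) - 1"
    by (simp add: A_seq_eq)
  show "(\<Sum>j = 0..2 * m_seq n - 1. (A_seq n + of_int j) ^ 3) =
      of_int (\<Sum>j = 0..m_seq n - 1. (B_seq n + 2 * j) ^ 3)"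
    unfolding run(5)[symmetric] by (simp add: A_seq_eq)
next
  let ?f = "\<lambda>n. (m_seq n, A_int n, B_seq n)"
  have "inj ?f"
    by (intro injI) (simp add: strict_mono_eq[OF strict_mono_m_seq])
  then have "infinite (range ?f)"
    by (simp add: finite_image_iff)
  moreover have "range ?f \<subseteq> {(m, A, B). ordered_cubic_run m A B}"
    using run_seq by auto
  ultimately show "infinite {(m, A, B). ordered_cubic_run m A B}"
    by (rule infinite_super[rotated])
qed

end
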